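(* For every positive integer $n$, the sequence of over-Mahonian numbers $\{i_{B'}(n,k)\}_{k}$ is log-concave in $k$; specifically, $$\left( i_{B'}(n,k)\right)^{2}-i_{B'}(n,k-1)\,i_{B'}(n,k+1)\geq 0$$ for all integers $k$ with $0<k\leq\binom{n}{2}$.
   Context: For $n\ge 1$, $B'_n$ denotes the set of overlined permutations of $\{1,\dots,n\}$ of the following kind: an element is a permutation $\sigma=\sigma_1\sigma_2\cdots\sigma_n$ of $\{1,\dots,n\}$ (in one-line notation) in which each entry $\sigma_i$ is independently either overlined or not overlined, subject to the condition that $\sigma_i$ may be overlined only if there is an index $j>i$ with $\sigma_i>\sigma_j$ (overlines are ignored in comparing entries). An inversion of such an element is a pair of positions $i<j$ with $\sigma_i>\sigma_j$, again ignoring overlines. The over-Mahonian number $i_{B'}(n,k)$ is the number of elements of $B'_n$ with exactly $k$ inversions; it is $0$ for integers $k$ outside $0\le k\le\binom n2$. *)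

theory Defs
  imports Complex_Main "HOL-Combinatorics.Permutations"
begin

definition inversions :: "nat \<Rightarrow> (nat \<Rightarrow> nat) \<Rightarrow> (nat \<times> nat) set" where
  "inversions n \<sigma> = {(i, j). i \<in> {1..n} \<and> j \<in> {1..n} \<and> i < j \<and> \<sigma> i > \<sigma> j}"

text \<open>
  An overlined permutation of \<open>{1..n}\<close> is a pair \<open>(\<sigma>, S)\<close>: \<open>\<sigma> i\<close> is the \<open>i\<close>-th entry of the
  one-line notation and \<open>S\<close> is the set of those positions \<open>i\<close> whose entry is overlined.
\<close>

definition overlined_perms :: "nat \<Rightarrow> ((nat \<Rightarrow> nat) \<times> nat set) set" where
  "overlined_perms n =
     {(\<sigma>, S). \<sigma> permutes {1..n} \<and> S \<subseteq> {1..n} \<and> (\<forall>i\<in>S. \<exists>j\<in>{1..n}. j > i \<and> \<sigma> i > \<sigma> j)}"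

text \<open>The index \<open>k\<close> is an integer, so that \<open>k - 1\<close> is not truncated.\<close>

definition over_mahonian :: "nat \<Rightarrow> int \<Rightarrow> nat" where
  "over_mahonian n k =
     card {(\<sigma>, S). (\<sigma>, S) \<in> overlined_perms n \<and> int (card (inversions n \<sigma>)) = k}"

end

theory Submission
  imports Defs "HOL-Computational_Algebra.Polynomial" "HOL-Library.FuncSet"
begin

text \<open>
  An overlined permutation is a permutation together with a set of positions chosen freely among
  the positions \<open>i\<close> whose entry exceeds some later entry. These are the positions where
  the Lehmer code \<open>c\<^sub>i = card {j > i. \<sigma> j < \<sigma> i}\<close> is nonzero, and the sum of the code is the number
  of inversions. The code identifies the permutations of \<open>{1..n}\<close> with the independent choices
  \<open>0 \<le> c\<^sub>i \<le> n - i\<close> (\<open>bij_betw_lehmer_code\<close>), so the overlined permutations, counted by inversions,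
  have the generating polynomial
  \[ \prod_{m=0}^{n-1} (1 + 2q + 2q^2 + \cdots + 2q^m), \]
  where an entry with \<open>c\<^sub>i \<noteq> 0\<close> counts twice because it may be overlined or not
  (\<open>over_mahonian_eq_icoeff\<close>).

  Each factor has a log-concave coefficient sequence, and so has their product. For the product,
  log-concavity is used in the form that all \<open>2 \<times> 2\<close> minors of the Toeplitz matrix of the
  coefficients are nonnegative. That matrix is multiplicative in the polynomial, and by the
  Cauchy--Binet identity a minor of a product is a sum of products of minors of the factors
  (\<open>log_concave_poly_mult\<close>).
\<close>

section \<open>Log-concave polynomials\<close>

text \<open>
  Indexing coefficients by the integers, with zeros on the left, makes a shift of the sequence a
  plain subtraction and leaves no boundary cases in the inequalities below.
\<close>

definition icoeff :: "'a::zero poly \<Rightarrow> int \<Rightarrow> 'a" where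
  "icoeff p k = (if k < 0 then 0 else coeff p (nat k))"

text \<open>
  Pulling two indices apart with their sum fixed does not increase the product. For nonnegative
  coefficients this is log-concavity together with the absence of internal zeros. The version that
  only compares \<open>k - 1, k + 1\<close> with \<open>k, k\<close> would not be closed under products.
\<close>

definition log_concave_poly :: "'a::linordered_idom poly \<Rightarrow> bool" where
  "log_concave_poly p \<longleftrightarrow>
     (\<forall>a b c d. a \<le> b \<longrightarrow> a \<le> c \<longrightarrow> a + d = b + c \<longrightarrow>
        icoeff p a * icoeff p d \<le> icoeff p b * icoeff p c)"

text \<open>
  The range \<open>{0..N}\<close> depends on neither \<open>k\<close> nor the shift \<open>e\<close>, so that several coefficients of a
  product, with one of the two factors shifted, can be written as sums over one common range.
\<close>

lemma icoeff_mult: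
  fixes p q :: "'a::comm_semiring_1 poly"
  assumes "0 \<le> e" "k + e \<le> N"
  shows "icoeff (p * q) k = (\<Sum>t\<in>{0..N}. icoeff p (k + e - t) * icoeff q (t - e))"
proof (cases "k < 0")
  case True
  then have "icoeff p (k + e - t) * icoeff q (t - e) = 0" for t
    by (simp add: icoeff_def)
  then show ?thesis
    using True by (simp add: icoeff_def)
next
  case False
  have "icoeff (p * q) k = (\<Sum>i\<le>nat k. coeff q i * coeff p (nat k - i))"
    using False by (simp add: icoeff_def coeff_mult mult.commute[of p])
  also have "\<dots> = (\<Sum>t\<in>{e..k + e}. icoeff p (k + e - t) * icoeff q (t - e))"
    by (rule sum.reindex_bij_witness[of _ "\<lambda>t. nat (t - e)" "\<lambda>i. int i + e"])
      (use False in \<open>auto simp: icoeff_def nat_diff_distrib mult.commute\<close>)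
  also have "\<dots> = (\<Sum>t\<in>{0..N}. icoeff p (k + e - t) * icoeff q (t - e))"
    by (rule sum.mono_neutral_left) (use assms in \<open>auto simp: icoeff_def\<close>)
  finally show ?thesis .
qed

text \<open>
  The difference of the two sides for \<open>p * q\<close> is a double sum over \<open>t, u\<close> in which the \<open>q\<close>-part
  \<open>G t u\<close> is antisymmetric. Adding the sum with \<open>t\<close> and \<open>u\<close> exchanged turns the \<open>p\<close>-part into an
  antisymmetric minor \<open>F t u\<close> as well. By log-concavity of the factors, both minors are nonnegative
  for \<open>t \<le> u\<close>, hence both are nonpositive for \<open>t \<ge> u\<close>, and every summand \<open>F t u * G t u\<close> is
  nonnegative. This is the Cauchy--Binet formula, written without restricting to \<open>t < u\<close>.
\<close>

lemma log_concave_poly_mult: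
  assumes p: "log_concave_poly p" and q: "log_concave_poly q"
  shows "log_concave_poly (p * q)"
  unfolding log_concave_poly_def
proof (intro allI impI)
  fix a b c d :: int
  assume ab: "a \<le> b" and ac: "a \<le> c" and sum: "a + d = b + c"
  define e where "e = b - a"
  have e: "0 \<le> e" and a: "a = b - e" and c: "c = d - e" and bd: "b \<le> d"
    using ab ac sum by (auto simp: e_def)
  let ?P = "icoeff p" and ?Q = "icoeff q" and ?T = "{0..d}"
  define F where "F t u = ?P (b - t) * ?P (d - u) - ?P (b - u) * ?P (d - t)" for t u
  define G where "G t u = ?Q t * ?Q (u - e) - ?Q (t - e) * ?Q u" for t u
  have F_nonneg: "0 \<le> F t u" and G_nonneg: "0 \<le> G t u" if "t \<le> u" for t u
  proof -
    show "0 \<le> F t u"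
      using p[unfolded log_concave_poly_def, rule_format, of "b - u" "b - t" "d - u" "d - t"]
        that bd by (simp add: F_def)
    show "0 \<le> G t u"
      using q[unfolded log_concave_poly_def, rule_format, of "t - e" t "u - e" u]
        that e by (simp add: G_def)
  qed
  have swap: "F u t = - F t u" "G u t = - G t u" for t u
    by (simp_all add: F_def G_def mult.commute)
  have FG: "0 \<le> F t u * G t u" for t u
  proof (cases "t \<le> u")
    case True
    then show ?thesis using F_nonneg G_nonneg by simp
  next
    case False
    then have "0 \<le> F u t * G u t" using F_nonneg G_nonneg by simp
    moreover have "F u t * G u t = F t u * G t u"
      unfolding swap(1)[of u t] swap(2)[of u t] by (rule minus_mult_minus)
    ultimately show ?thesis by simp
  qed
  \<comment> \<open>Coefficients \<open>b\<close> and \<open>a = b - e\<close> use the same values of \<open>p\<close>, and so do \<open>d\<close> and \<open>c = d - e\<close>;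
      the shift by \<open>e\<close> is put on \<open>q\<close>. Thus each product of two coefficients carries the same
      factor \<open>?P (b - t) * ?P (d - u)\<close>.\<close>
  define D where "D = (\<Sum>t\<in>?T. \<Sum>u\<in>?T. ?P (b - t) * ?P (d - u) * G t u)"
  have conv: "icoeff (p * q) b = (\<Sum>t\<in>?T. ?P (b - t) * ?Q t)"
    "icoeff (p * q) d = (\<Sum>t\<in>?T. ?P (d - t) * ?Q t)"
    "icoeff (p * q) a = (\<Sum>t\<in>?T. ?P (b - t) * ?Q (t - e))"
    "icoeff (p * q) c = (\<Sum>t\<in>?T. ?P (d - t) * ?Q (t - e))"
    using icoeff_mult[of 0 b d p q] icoeff_mult[of 0 d d p q]
      icoeff_mult[of e a d p q] icoeff_mult[of e c d p q] e a c bd by simp_all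
  have D: "icoeff (p * q) b * icoeff (p * q) c - icoeff (p * q) a * icoeff (p * q) d = D"
    unfolding conv D_def G_def sum_product sum_subtractf[symmetric]
    by (intro sum.cong refl) (simp add: algebra_simps)
  have "D = (\<Sum>t\<in>?T. \<Sum>u\<in>?T. ?P (b - u) * ?P (d - t) * G u t)"
    unfolding D_def by (rule sum.swap)
  also have "\<dots> = (\<Sum>t\<in>?T. \<Sum>u\<in>?T. - (?P (b - u) * ?P (d - t) * G t u))"
    by (intro sum.cong refl) (metis swap(2) mult_minus_right)
  finally have D': "D = (\<Sum>t\<in>?T. \<Sum>u\<in>?T. - (?P (b - u) * ?P (d - t) * G t u))" .
  have "D + D = (\<Sum>t\<in>?T. \<Sum>u\<in>?T. F t u * G t u)"
    by (subst (2) D', subst D_def)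
      (simp only: F_def sum.distrib[symmetric], intro sum.cong refl, simp add: algebra_simps)
  also have "\<dots> \<ge> 0"
    by (intro sum_nonneg FG)
  finally have "0 \<le> D" by simp
  then show "icoeff (p * q) a * icoeff (p * q) d \<le> icoeff (p * q) b * icoeff (p * q) c"
    using D by simp
qed

lemma log_concave_poly_prod:
  "(\<And>i. i \<in> I \<Longrightarrow> log_concave_poly (f i)) \<Longrightarrow> log_concave_poly (prod f I)"
proof (induction I rule: infinite_finite_induct)
  case (insert i I)
  then show ?case by (simp add: log_concave_poly_mult)
qed (auto simp: log_concave_poly_def icoeff_def coeff_1)

text \<open>The number of ways to mark an entry that exceeds exactly \<open>c\<close> later entries.\<close>

definition overline_weight :: "nat \<Rightarrow> int" where
  "overline_weight c = (if c = 0 then 1 else 2)"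

definition entry_poly :: "nat \<Rightarrow> int poly" where
  "entry_poly m = (\<Sum>c\<in>{0..m}. monom (overline_weight c) c)"

lemma log_concave_entry_poly: "log_concave_poly (entry_poly m)"
proof -
  have entry: "icoeff (entry_poly m) i = (if i < 0 \<or> int m < i then 0 else if i = 0 then 1 else 2)" for i
    by (auto simp: entry_poly_def icoeff_def overline_weight_def coeff_sum)
  show ?thesis
    unfolding log_concave_poly_def
  proof (intro allI impI)
    fix a b c d :: int
    assume sum: "a \<le> b" "a \<le> c" "a + d = b + c"
    show "icoeff (entry_poly m) a * icoeff (entry_poly m) d
      \<le> icoeff (entry_poly m) b * icoeff (entry_poly m) c"
    proof (cases "a < 0 \<or> int m < d")
      case True
      then show ?thesis by (auto simp: entry)
    next
      case False
      then have "0 \<le> b" "b \<le> int m" "0 \<le> c" "c \<le> int m" using sum by auto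
      moreover have "a = 0 \<and> d = c" if "b = 0" using that False sum by auto
      moreover have "a = 0 \<and> d = b" if "c = 0" using that False sum by auto
      ultimately show ?thesis using False by (simp add: entry)
    qed
  qed
qed

section \<open>Lehmer codes\<close>

definition lehmer_code :: "nat \<Rightarrow> (nat \<Rightarrow> nat) \<Rightarrow> nat \<Rightarrow> nat" where
  "lehmer_code n \<sigma> = (\<lambda>i\<in>{1..n}. card {j\<in>{1..n}. i < j \<and> \<sigma> j < \<sigma> i})"

definition codes :: "nat \<Rightarrow> (nat \<Rightarrow> nat) set" where
  "codes n = (\<Pi>\<^sub>E i\<in>{1..n}. {0..n - i})"

lemma finite_codes: "finite (codes n)"
  unfolding codes_def by (rule finite_PiE) auto

lemma lehmer_code_in_codes: "lehmer_code n \<sigma> \<in> codes n"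
proof -
  have "card {j\<in>{1..n}. i < j \<and> \<sigma> j < \<sigma> i} \<le> n - i" for i
  proof -
    have "card {j\<in>{1..n}. i < j \<and> \<sigma> j < \<sigma> i} \<le> card {i<..n}"
      by (intro card_mono) auto
    then show ?thesis by simp
  qed
  then show ?thesis
    by (auto simp: lehmer_code_def codes_def)
qed

text \<open>
  The entries after position \<open>i\<close> that are smaller than the entry at \<open>i\<close> are the smaller values not
  used before \<open>i\<close>. When the prefixes agree, these sets of values are nested, and the smaller entry
  itself belongs only to the larger set. Applied at the first position where two permutations
  differ, this shows that the code determines the permutation.
\<close>

lemma lehmer_code_less:
  assumes \<sigma>: "\<sigma> permutes {1..n}" and \<tau>: "\<tau> permutes {1..n}"
    and i: "i \<in> {1..n}" and eq: "\<And>j. j < i \<Longrightarrow> \<sigma> j = \<tau> j" and less: "\<sigma> i < \<tau> i"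
  shows "lehmer_code n \<sigma> i < lehmer_code n \<tau> i"
proof -
  have image: "\<rho> ` {j\<in>{1..n}. i < j \<and> \<rho> j < \<rho> i} = {v\<in>{1..n}. v < \<rho> i} - \<rho> ` {1..<i}"
    if "\<rho> permutes {1..n}" for \<rho>
  proof (intro equalityI subsetI)
    fix v assume "v \<in> \<rho> ` {j\<in>{1..n}. i < j \<and> \<rho> j < \<rho> i}"
    then obtain j where "j \<in> {1..n}" "i < j" "\<rho> j < \<rho> i" "v = \<rho> j" by auto
    then show "v \<in> {v\<in>{1..n}. v < \<rho> i} - \<rho> ` {1..<i}"
      using permutes_in_image[OF that, of j] injD[OF permutes_inj[OF that]] by fastforce
  next
    fix v assume v: "v \<in> {v\<in>{1..n}. v < \<rho> i} - \<rho> ` {1..<i}"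
    then have "v \<in> \<rho> ` {1..n}" using permutes_image[OF that] by simp
    then obtain j where j: "j \<in> {1..n}" "v = \<rho> j" by blast
    have "j \<noteq> i" "\<not> j < i" using v j by auto
    then show "v \<in> \<rho> ` {j\<in>{1..n}. i < j \<and> \<rho> j < \<rho> i}" using v j by auto
  qed
  have code: "lehmer_code n \<rho> i = card ({v\<in>{1..n}. v < \<rho> i} - \<rho> ` {1..<i})"
    if "\<rho> permutes {1..n}" for \<rho>
    unfolding image[OF that, symmetric] using i
    by (simp add: lehmer_code_def card_image permutes_inj_on[OF that])
  have same: "\<sigma> ` {1..<i} = \<tau> ` {1..<i}"
    using eq by (intro image_cong) auto
  have "\<sigma> i \<notin> \<sigma> ` {1..<i}"
    using injD[OF permutes_inj[OF \<sigma>]] by fastforce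
  moreover have "\<sigma> i \<in> {1..n}"
    using permutes_in_image[OF \<sigma>] i by simp
  ultimately have "{v\<in>{1..n}. v < \<sigma> i} - \<sigma> ` {1..<i} \<subset> {v\<in>{1..n}. v < \<tau> i} - \<tau> ` {1..<i}"
    using less same by auto
  then show ?thesis
    unfolding code[OF \<sigma>] code[OF \<tau>] by (intro psubset_card_mono) auto
qed

text \<open>
  Surjectivity follows from counting: there are \<open>n!\<close> codes, as many as permutations.
\<close>

lemma bij_betw_lehmer_code:
  "bij_betw (lehmer_code n) {\<sigma>. \<sigma> permutes {1..n}} (codes n)"
proof -
  have inj: "inj_on (lehmer_code n) {\<sigma>. \<sigma> permutes {1..n}}"
  proof (rule inj_onI, rule ccontr)
    fix \<sigma> \<tau> assume "\<sigma> \<in> {\<sigma>. \<sigma> permutes {1..n}}" "\<tau> \<in> {\<sigma>. \<sigma> permutes {1..n}}"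
      and code: "lehmer_code n \<sigma> = lehmer_code n \<tau>" and "\<sigma> \<noteq> \<tau>"
    then have perm: "\<sigma> permutes {1..n}" "\<tau> permutes {1..n}" by auto
    define i where "i = (LEAST i. \<sigma> i \<noteq> \<tau> i)"
    have i: "\<sigma> i \<noteq> \<tau> i"
      unfolding i_def using LeastI_ex[of "\<lambda>i. \<sigma> i \<noteq> \<tau> i"] \<open>\<sigma> \<noteq> \<tau>\<close> by fastforce
    have before: "\<sigma> j = \<tau> j" if "j < i" for j
      using not_less_Least[of j "\<lambda>i. \<sigma> i \<noteq> \<tau> i"] that unfolding i_def by blast
    have "i \<in> {1..n}"
      using i permutes_not_in[OF perm(1)] permutes_not_in[OF perm(2)] by metis
    then have "lehmer_code n \<sigma> i < lehmer_code n \<tau> i \<or> lehmer_code n \<tau> i < lehmer_code n \<sigma> i"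
      using i lehmer_code_less[OF perm(1,2)] lehmer_code_less[OF perm(2,1)] before
      by (metis linorder_neqE_nat)
    then show False
      by (simp add: code)
  qed
  have "card (codes n) = (\<Prod>i\<in>{1..n}. Suc (n - i))"
    by (simp add: codes_def card_PiE)
  also have "\<dots> = \<Prod>{1..n}"
    by (rule prod.reindex_bij_witness[of _ "\<lambda>i. Suc (n - i)" "\<lambda>i. Suc (n - i)"]) auto
  also have "\<dots> = card {\<sigma>. \<sigma> permutes {1..n}}"
    using card_permutations[of "{1..n}" n] by (simp add: fact_prod)
  finally have card: "card (codes n) = card {\<sigma>. \<sigma> permutes {1..n}}" .
  have "lehmer_code n ` {\<sigma>. \<sigma> permutes {1..n}} = codes n"
    using card card_image[OF inj] lehmer_code_in_codes
    by (intro card_subset_eq finite_codes) auto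
  then show ?thesis using inj by (simp add: bij_betw_def)
qed

lemma card_inversions: "card (inversions n \<sigma>) = (\<Sum>i\<in>{1..n}. lehmer_code n \<sigma> i)"
proof -
  have "inversions n \<sigma> = Sigma {1..n} (\<lambda>i. {j\<in>{1..n}. i < j \<and> \<sigma> j < \<sigma> i})"
    by (auto simp: inversions_def)
  then show ?thesis by (simp add: lehmer_code_def)
qed

section \<open>The generating polynomial\<close>

text \<open>
  The overlined permutations over a fixed \<open>\<sigma>\<close> correspond to the subsets of the support of its code,
  and the number \<open>2 ^ card\<close> of these subsets is the product of the weights of the code entries.
\<close>

lemma over_mahonian_eq_sum_codes:
  "int (over_mahonian n k) =
     (\<Sum>c | c \<in> codes n \<and> int (\<Sum>i\<in>{1..n}. c i) = k. \<Prod>i\<in>{1..n}. overline_weight (c i))"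
proof -
  let ?A = "{\<sigma>. \<sigma> permutes {1..n} \<and> int (\<Sum>i\<in>{1..n}. lehmer_code n \<sigma> i) = k}"
  let ?S = "\<lambda>\<sigma>. {i\<in>{1..n}. lehmer_code n \<sigma> i \<noteq> 0}"
  have fin: "finite ?A"
    using finite_permutations[of "{1..n}"] by (rule rev_finite_subset) auto
  have "(\<exists>j\<in>{1..n}. j > i \<and> \<sigma> i > \<sigma> j) \<longleftrightarrow> lehmer_code n \<sigma> i \<noteq> 0" if "i \<in> {1..n}" for \<sigma> i
    using that by (auto simp: lehmer_code_def)
  then have "{(\<sigma>, S). (\<sigma>, S) \<in> overlined_perms n \<and> int (card (inversions n \<sigma>)) = k}
      = Sigma ?A (\<lambda>\<sigma>. Pow (?S \<sigma>))"
    unfolding overlined_perms_def card_inversions by blast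
  then have "int (over_mahonian n k) = (\<Sum>\<sigma>\<in>?A. 2 ^ card (?S \<sigma>))"
    using fin by (simp add: over_mahonian_def card_Pow)
  also have "\<dots> = (\<Sum>\<sigma>\<in>?A. \<Prod>i\<in>{1..n}. overline_weight (lehmer_code n \<sigma> i))"
  proof (rule sum.cong[OF refl])
    fix \<sigma>
    have "(2::int) ^ card (?S \<sigma>) = (\<Prod>i\<in>?S \<sigma>. overline_weight (lehmer_code n \<sigma> i))"
      by (simp add: overline_weight_def)
    also have "\<dots> = (\<Prod>i\<in>{1..n}. overline_weight (lehmer_code n \<sigma> i))"
      by (rule prod.mono_neutral_left) (auto simp: overline_weight_def)
    finally show "(2::int) ^ card (?S \<sigma>)
      = (\<Prod>i\<in>{1..n}. overline_weight (lehmer_code n \<sigma> i))" .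
  qed
  also have "\<dots> = (\<Sum>c | c \<in> codes n \<and> int (\<Sum>i\<in>{1..n}. c i) = k.
      \<Prod>i\<in>{1..n}. overline_weight (c i))"
  proof (rule sum.reindex_bij_betw)
    show "bij_betw (lehmer_code n) ?A {c \<in> codes n. int (\<Sum>i\<in>{1..n}. c i) = k}"
      using bij_betw_lehmer_code[of n] unfolding bij_betw_def
      by (auto simp: inj_on_def image_iff)
  qed
  finally show ?thesis .
qed

lemma prod_monom:
  "(\<Prod>i\<in>I. monom (f i) (g i)) = monom (\<Prod>i\<in>I. f i) (\<Sum>i\<in>I. g i)"
  by (induction I rule: infinite_finite_induct) (auto simp: mult_monom)

lemma over_mahonian_eq_icoeff:
  "int (over_mahonian n k) = icoeff (\<Prod>i\<in>{1..n}. entry_poly (n - i)) k"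
proof -
  have "(\<Prod>i\<in>{1..n}. entry_poly (n - i))
      = (\<Sum>c\<in>codes n. \<Prod>i\<in>{1..n}. monom (overline_weight (c i)) (c i))"
    unfolding entry_poly_def codes_def by (rule prod_sum_PiE) auto
  also have "\<dots> = (\<Sum>c\<in>codes n. monom (\<Prod>i\<in>{1..n}. overline_weight (c i)) (\<Sum>i\<in>{1..n}. c i))"
    by (simp only: prod_monom)
  finally have coeff: "coeff (\<Prod>i\<in>{1..n}. entry_poly (n - i)) m
      = (\<Sum>c | c \<in> codes n \<and> (\<Sum>i\<in>{1..n}. c i) = m. \<Prod>i\<in>{1..n}. overline_weight (c i))" for m
    using finite_codes[of n] by (simp add: coeff_sum sum.If_cases Int_def)
  show ?thesis
  proof (cases "k < 0")
    case True
    then have "{c. c \<in> codes n \<and> int (\<Sum>i\<in>{1..n}. c i) = k} = {}"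
      by (auto simp del: of_nat_sum)
    then show ?thesis
      unfolding over_mahonian_eq_sum_codes icoeff_def using True by (simp only: sum.empty if_True)
  next
    case False
    then have "{c. c \<in> codes n \<and> int (\<Sum>i\<in>{1..n}. c i) = k}
        = {c. c \<in> codes n \<and> (\<Sum>i\<in>{1..n}. c i) = nat k}"
      by (intro Collect_cong) linarith
    then show ?thesis
      unfolding over_mahonian_eq_sum_codes icoeff_def using False by (simp only: coeff if_False)
  qed
qed

theorem theorem4p2:
  fixes n :: nat and k :: int
  assumes "n \<ge> 1" and "0 < k" and "k \<le> int (n choose 2)"
  shows "(int (over_mahonian n k))\<^sup>2
           - int (over_mahonian n (k - 1)) * int (over_mahonian n (k + 1)) \<ge> 0"
proof -
  have "log_concave_poly (\<Prod>i\<in>{1..n}. entry_poly (n - i))"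
    by (intro log_concave_poly_prod log_concave_entry_poly)
  from this[unfolded log_concave_poly_def, rule_format, of "k - 1" k k "k + 1"]
  show ?thesis
    by (simp add: over_mahonian_eq_icoeff power2_eq_square)
qed

end
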